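(* For every fixed integer $r\geq 1$ and every $\epsilon>0$, for all sufficiently large $k$, $$AW(k;r)\geq \frac{k^{2r-1-\epsilon}}{2^{r-1}(40r)^{r^2-1}}.$$
   Context: A sequence of positive integers $w_1<\dots<w_n$ is an ascending wave if $w_{i+1}-w_i \geq w_i-w_{i-1}$ for $2\le i\le n-1$. For positive integers $k,r$, $AW(k;r)$ denotes the least positive integer $N$ such that every $r$-coloring of $\{1,\dots,N\}$ contains a $k$-term monochromatic ascending wave. *)

theory Defs
  imports "HOL-Analysis.Analysis"
begin

definition ascending_wave :: "nat list \<Rightarrow> bool" where
  "ascending_wave w \<longleftrightarrow>
     (\<forall>i. i < length w \<longrightarrow> 0 < w ! i) \<and>
     (\<forall>i. i + 1 < length w \<longrightarrow> w ! i < w ! (i + 1)) \<and>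
     (\<forall>i. 0 < i \<and> i + 1 < length w \<longrightarrow> w ! (i + 1) - w ! i \<ge> w ! i - w ! (i - 1))"

definition has_mono_wave :: "nat \<Rightarrow> nat \<Rightarrow> (nat \<Rightarrow> nat) \<Rightarrow> bool" where
  "has_mono_wave k N c \<longleftrightarrow>
     (\<exists>w. length w = k \<and> ascending_wave w \<and> set w \<subseteq> {1..N} \<and>
          (\<forall>x\<in>set w. \<forall>y\<in>set w. c x = c y))"

definition AW :: "nat \<Rightarrow> nat \<Rightarrow> nat" where
  "AW k r = (LEAST N. 0 < N \<and>
     (\<forall>c. (\<forall>x\<in>{1..N}. c x < r) \<longrightarrow> has_mono_wave k N c))"

end

theory Submission
  imports Defs "HOL-Real_Asymp.Real_Asymp"
begin

text \<open>
  The constant in the denominator is at least \<open>1\<close>, so it suffices to find, for all large \<open>k\<close>,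
  an \<open>r\<close>-colouring of an interval of length at least \<open>k powr (2r - 1 - \<epsilon>)\<close> without a
  monochromatic \<open>k\<close>-term wave; this goes by induction on \<open>r\<close>. Cut the interval into
  \<open>k powr (2 - o(1))\<close> blocks of length \<open>M\<close>. Every block omits one of the \<open>r + 1\<close> colours, chosen
  at random, and carries a copy of an \<open>r\<close>-colouring in the other colours without waves of
  about \<open>k powr (1 - o(1))\<close> terms. With \<open>l = k powr \<delta>\<close>, a union bound shows that for some choice of
  the omitted colours, every \<open>l\<close>-term arithmetic progression with difference at least \<open>2M\<close> has,
  for every colour \<open>c\<close>, a term whose block and the next block both omit \<open>c\<close>.

  A wave of colour \<open>c\<close> can stay in each block only for a short time, so it soon has to jump
  across two blocks that omit \<open>c\<close>, and from then on its gaps are at least \<open>2M\<close>. As the total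
  length bounds the gaps, some window of \<open>l\<close> consecutive terms has gaps growing by at most
  \<open>M / l\<close>. There the wave stays within \<open>M\<close> above an arithmetic progression, and so it hits a block
  omitting \<open>c\<close>, a contradiction.
\<close>

section \<open>Waves as functions, and their gaps\<close>

text \<open>Convexity is stated additively, without truncated subtraction. Only the values at
  \<open>i < k\<close> matter.\<close>

definition wave :: "nat \<Rightarrow> (nat \<Rightarrow> nat) \<Rightarrow> bool" where
  "wave k w \<longleftrightarrow> (\<forall>i. Suc i < k \<longrightarrow> w i < w (Suc i)) \<and>
     (\<forall>i. Suc (Suc i) < k \<longrightarrow> 2 * w (Suc i) \<le> w i + w (Suc (Suc i)))"

text \<open>Intervals are \<open>{0..<N}\<close> here, which suits \<open>div\<close> and \<open>mod\<close>; \<open>less_AW\<close> shifts to \<open>{1..N}\<close>.\<close>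

definition wave_free :: "nat \<Rightarrow> nat \<Rightarrow> (nat \<Rightarrow> nat) \<Rightarrow> bool" where
  "wave_free k N f \<longleftrightarrow>
     (\<nexists>w. wave k w \<and> (\<forall>i<k. w i < N) \<and> (\<forall>i<k. f (w i) = f (w 0)))"

definition gap :: "(nat \<Rightarrow> nat) \<Rightarrow> nat \<Rightarrow> nat" where
  "gap w i = w (Suc i) - w i"

lemma wave_Suc: "wave k w \<Longrightarrow> Suc i < k \<Longrightarrow> w (Suc i) = w i + gap w i"
  by (auto simp: wave_def gap_def)

lemma wave_gap_mono:
  assumes "wave k w" "i \<le> j" "Suc j < k"
  shows "gap w i \<le> gap w j"
  using assms(2,3)
proof (induction j rule: dec_induct)
  case (step j)
  have "w j < w (Suc j)" "2 * w (Suc j) \<le> w j + w (Suc (Suc j))"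
    using assms(1) step.prems by (auto simp: wave_def)
  then have "gap w j \<le> gap w (Suc j)"
    unfolding gap_def by linarith
  with step show ?case by simp
qed simp

text \<open>Gaps never shrink, so from \<open>s\<close> on the wave stays above the line of slope
  \<open>gap w s\<close>. With \<open>wave_upper\<close> this compares a stretch of the wave with an
  arithmetic progression.\<close>

lemma wave_lower:
  assumes "wave k w" "s + i < k"
  shows "w s + i * gap w s \<le> w (s + i)"
  using assms(2)
proof (induction i)
  case (Suc i)
  have "gap w s \<le> gap w (s + i)"
    using Suc.prems by (intro wave_gap_mono[OF assms(1)]) auto
  with Suc wave_Suc[OF assms(1), of "s + i"] show ?case by simp
qed simp

lemma wave_upper:
  assumes "wave k w" "s + i \<le> j" "Suc j < k"
  shows "w (s + i) \<le> w s + i * gap w j"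
  using assms(2)
proof (induction i)
  case (Suc i)
  have "gap w (s + i) \<le> gap w j"
    using Suc.prems assms(3) by (intro wave_gap_mono[OF assms(1)]) auto
  with Suc assms(3) wave_Suc[OF assms(1), of "s + i"] show ?case by simp
qed simp

lemma wave_mono:
  assumes "wave k w" "i \<le> j" "j < k"
  shows "w i \<le> w j"
  using wave_lower[OF assms(1), of i "j - i"] assms(2,3) by simp

lemma wave_shift:
  assumes "wave k w" "s + m \<le> k" "\<And>i. i < m \<Longrightarrow> a \<le> w (s + i)"
  shows "wave m (\<lambda>i. w (s + i) - a)"
  unfolding wave_def
proof (intro conjI allI impI)
  fix i assume i: "Suc i < m"
  have "w (s + i) < w (Suc (s + i))"
    using assms(1,2) i by (auto simp: wave_def)
  with assms(3)[of i] i show "w (s + i) - a < w (s + Suc i) - a" by simp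
next
  fix i assume i: "Suc (Suc i) < m"
  have "2 * w (Suc (s + i)) \<le> w (s + i) + w (Suc (Suc (s + i)))"
    using assms(1,2) i by (auto simp: wave_def)
  with assms(3)[of i] assms(3)[of "Suc i"] assms(3)[of "Suc (Suc i)"] i
  show "2 * (w (s + Suc i) - a) \<le> w (s + i) - a + (w (s + Suc (Suc i)) - a)" by simp
qed

section \<open>Block colourings in which each block omits a colour\<close>

text \<open>The increasing enumeration of the naturals other than \<open>c\<close>; it relabels
  \<open>r\<close> colours so that \<open>c\<close> is omitted.\<close>

definition skip :: "nat \<Rightarrow> nat \<Rightarrow> nat" where
  "skip c x = (if x < c then x else Suc x)"

lemma skip_neq: "skip c x \<noteq> c"
  by (simp add: skip_def)

lemma skip_inj: "skip c x = skip c y \<Longrightarrow> x = y"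
  by (auto simp: skip_def split: if_splits)

lemma skip_less: "x < r \<Longrightarrow> skip c x < Suc r"
  by (simp add: skip_def)

text \<open>Two consecutive blocks serve twice: jumping over both forces a gap of at least
  \<open>2 * M\<close>, and a point at most \<open>M\<close> above a progression term still lies in
  one of them. Differences of at least \<open>2 * M\<close> make the block pairs disjoint, hence
  independent under a random choice.\<close>

definition hits_progressions :: "nat \<Rightarrow> nat \<Rightarrow> nat \<Rightarrow> nat \<Rightarrow> (nat \<Rightarrow> nat) \<Rightarrow> bool" where
  "hits_progressions n M l N g \<longleftrightarrow>
     (\<forall>c<n. \<forall>a\<le>N. \<forall>d\<le>N. 2 * M \<le> d \<longrightarrow>
        (\<exists>i<l. g ((a + i * d) div M) = c \<and> g (Suc ((a + i * d) div M)) = c))"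

text \<open>The \<open>k\<close> terms are budgeted in three stretches: \<open>2 * l * m\<close>
  terms to force large gaps, \<open>W\<close> windows of length \<open>l\<close> to find nearly
  constant gaps, and \<open>R\<close> more to bound the earlier gaps by the interval length.\<close>

lemma wave_free_blocks:
  fixes \<phi> g :: "nat \<Rightarrow> nat" and M B k m l r W R :: nat
  defines "f \<equiv> \<lambda>x. skip (g (x div M)) (\<phi> (x mod M))"
  assumes \<phi>: "\<And>x. x < M \<Longrightarrow> \<phi> x < r" "wave_free m M \<phi>"
    and g: "\<And>x. g x < Suc r"
    and hits: "hits_progressions (Suc r) M l (B * M) g"
    and M: "0 < M" and B: "2 \<le> B"
    and k: "2 * l * m + W * l + R < k" and WR: "B * l < W * R"
  shows "wave_free k (B * M) f"
  unfolding wave_free_def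
proof (intro notI, elim exE conjE)
  fix w assume w: "wave k w" and wN: "\<forall>i<k. w i < B * M" and col: "\<forall>i<k. f (w i) = f (w 0)"
  define c where "c = f (w 0)"
  have fc: "f (w i) = c" if "i < k" for i
    using col that unfolding c_def by blast
  have avoid: "g (w i div M) \<noteq> c" if "i < k" for i
    using fc[OF that] unfolding f_def by (metis skip_neq)
  have "c < Suc r"
    unfolding c_def f_def by (intro skip_less \<phi>) (simp add: M)
  with hits have hit: "\<exists>i<l. g ((a + i * d) div M) = c \<and> g (Suc ((a + i * d) div M)) = c"
    if "a \<le> B * M" "d \<le> B * M" "2 * M \<le> d" for a d
    using that unfolding hits_progressions_def by blast
  have R: "0 < R"  using WR by (auto intro: Nat.gr0I)
  have div_mono: "w i div M \<le> w j div M" if "i \<le> j" "j < k" for i j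
    by (intro div_le_mono wave_mono[OF w] that)

  \<comment> \<open>Otherwise \<open>m\<close> successive terms share a block; taken modulo
    \<open>M\<close> they form a monochromatic wave of \<open>\<phi>\<close>, as \<open>skip\<close>
    is injective.\<close>
  have leave: "w s div M < w (s + m) div M" if s: "s + m < k" for s
  proof (rule ccontr)
    assume "\<not> w s div M < w (s + m) div M"
    then have same: "w (s + i) div M = w s div M" if "i \<le> m" for i
      using div_mono[of s "s + i"] div_mono[of "s + i" "s + m"] s that by simp
    define v where "v i = w (s + i) - w s div M * M" for i
    have v: "v i = w (s + i) mod M" if "i \<le> m" for i
      using same[OF that] by (simp add: v_def modulo_nat_def)
    have "wave m v"
      unfolding v_def
    proof (rule wave_shift[OF w])
      fix i assume "i < m"
      then show "w s div M * M \<le> w (s + i)"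
        using same[of i] by (metis div_times_less_eq_dividend less_imp_le)
    qed (use s in simp)
    moreover have "\<forall>i<m. v i < M" using v M by simp
    moreover have "\<phi> (v i) = \<phi> (v 0)" if "i < m" for i
    proof -
      have "f (w (s + i)) = f (w (s + 0))" using fc[of "s + i"] fc[of s] s that by simp
      then show ?thesis
        using v[of i] v[of 0] same[of i] that unfolding f_def by (auto dest: skip_inj)
    qed
    ultimately show False using \<phi>(2) unfolding wave_free_def by blast
  qed

  define t where "t = 2 * l * m"
  have climb: "w 0 div M + j \<le> w (j * m) div M" if "j \<le> 2 * l" for j
    using that
  proof (induction j)
    case (Suc j)
    have "Suc j * m \<le> 2 * l * m" using Suc.prems by (intro mult_le_mono1)
    then have "j * m + m < k" using k by simp
    from leave[OF this] Suc show ?case by (simp add: add.commute)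
  qed simp

  \<comment> \<open>The progression of difference \<open>2 * M\<close> starts at a block boundary,
    so its terms lie in the blocks \<open>w 0 div M + 2 * i\<close>, all below the block of
    \<open>w t\<close> by \<open>climb\<close>.\<close>
  have gap_t: "2 * M \<le> gap w t"
  proof -
    have "w 0 < B * M" using wN k by simp
    then have "w 0 div M * M \<le> B * M"
      using div_times_less_eq_dividend[of "w 0" M] by linarith
    moreover have "2 * M \<le> B * M" using B by simp
    ultimately obtain i where i: "i < l" and
      gi: "g ((w 0 div M * M + i * (2 * M)) div M) = c"
          "g (Suc ((w 0 div M * M + i * (2 * M)) div M)) = c"
      using hit by blast
    define b where "b = w 0 div M + 2 * i"
    have "w 0 div M * M + i * (2 * M) = b * M" by (simp add: b_def algebra_simps)
    then have gb: "g b = c" "g (Suc b) = c" using gi M by auto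
    have tb: "b < w t div M"
      using climb[of "2 * l"] i by (simp add: b_def t_def)
    \<comment> \<open>\<open>w j\<close> is the first term beyond block \<open>b\<close>. The wave
      visits neither \<open>b\<close> nor \<open>Suc b\<close>, so the step from \<open>p\<close> to
      \<open>j\<close> jumps over both.\<close>
    define j where "j = (LEAST j. b < w j div M)"
    have j: "b < w j div M" and jt: "j \<le> t"
      using tb unfolding j_def by (rule LeastI, intro Least_le)
    have tk: "Suc t < k" using k R unfolding t_def by linarith
    have "j \<noteq> 0" using j by (auto simp: b_def intro: Nat.gr0I)
    then obtain p where p: "j = Suc p" by (cases j) auto
    have "\<not> b < w p div M" using not_less_Least[of p "\<lambda>j. b < w j div M"] p j_def by simp
    moreover have "w p div M \<noteq> b" using avoid[of p] gb p jt tk by auto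
    ultimately have "w p div M < b" by simp
    then have lo: "w p < b * M" using M by (simp add: div_less_iff_less_mult)
    have "w j div M \<noteq> Suc b" using avoid[of j] gb jt tk by auto
    with j have "b + 2 \<le> w j div M" by simp
    then have hi: "(b + 2) * M \<le> w j" using M by (simp add: less_eq_div_iff_mult_less_eq)
    have "2 * M \<le> gap w p" using lo hi p unfolding gap_def by (simp add: algebra_simps)
    also have "\<dots> \<le> gap w t" using p jt tk by (intro wave_gap_mono[OF w]) auto
    finally show ?thesis .
  qed

  define e where "e = t + W * l"
  have ek: "e + R < k" using k by (simp add: e_def t_def)
  \<comment> \<open>The \<open>R\<close> steps after \<open>e\<close> have gaps of at least
    \<open>gap w e\<close> and must fit into the interval.\<close>
  have "R * gap w e < B * M"
    using wave_lower[OF w ek] wN ek by fastforce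
  \<comment> \<open>If the gap grew by more than \<open>M / l\<close> in every window, it would be
    at least \<open>W * M / l\<close> at \<open>e\<close>, contradicting the previous bound since
    \<open>B * l < W * R\<close>.\<close>
  have "\<exists>j<W. l * gap w (t + Suc j * l) \<le> l * gap w (t + j * l) + M"
  proof (rule ccontr)
    assume "\<not> ?thesis"
    then have far: "l * gap w (t + j * l) + M \<le> l * gap w (t + Suc j * l)" if "j < W" for j
      using that by force
    have "j * M \<le> l * gap w (t + j * l)" if "j \<le> W" for j
      using that
    proof (induction j)
      case (Suc j)
      with far[of j] show ?case by simp
    qed simp
    then have "W * M \<le> l * gap w e" by (simp add: e_def)
    then have "R * (W * M) \<le> R * (l * gap w e)" by (rule mult_le_mono2)
    also have "\<dots> = l * (R * gap w e)" by simp
    also have "\<dots> \<le> l * (B * M)" using \<open>R * gap w e < B * M\<close> by simp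
    finally have "(W * R) * M \<le> (B * l) * M" by (simp add: ac_simps)
    with WR M show False by simp
  qed
  then obtain j where j: "j < W" and near: "l * gap w (t + Suc j * l) \<le> l * gap w (t + j * l) + M"
    by blast
  define s where "s = t + j * l"
  have "Suc j * l \<le> W * l" using j by (intro mult_le_mono1) simp
  then have sl: "s + l \<le> e" by (simp add: s_def e_def)
  have gs: "2 * M \<le> gap w s"
    using gap_t wave_gap_mono[OF w, of t s] sl ek R s_def by simp
  have "gap w s \<le> gap w e"
    using sl ek R by (intro wave_gap_mono[OF w]) auto
  also have "\<dots> \<le> R * gap w e" using R by simp
  finally have "gap w s \<le> B * M" using \<open>R * gap w e < B * M\<close> by simp
  moreover have "w s \<le> B * M" using wN sl ek by (simp add: less_imp_le)
  ultimately obtain i where i: "i < l" and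
    gi: "g ((w s + i * gap w s) div M) = c" "g (Suc ((w s + i * gap w s) div M)) = c"
    using hit gs by blast
  have sk: "s + i < k" using i sl ek by simp
  have lo: "w s + i * gap w s \<le> w (s + i)" by (rule wave_lower[OF w sk])
  \<comment> \<open>The excess over the progression is at most \<open>i * h\<close>, where
    \<open>h\<close> is the growth of the gap over the window and
    \<open>l * h \<le> M\<close>.\<close>
  have "w (s + i) \<le> w s + i * gap w (s + l)"
    using i sl ek R by (intro wave_upper[OF w]) auto
  also have "\<dots> \<le> w s + i * gap w s + M"
  proof -
    have "gap w s \<le> gap w (s + l)" using sl ek R by (intro wave_gap_mono[OF w]) auto
    then obtain h where h: "gap w (s + l) = gap w s + h" using le_Suc_ex by blast
    have "s + l = t + Suc j * l" by (simp add: s_def)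
    with near have "l * gap w (s + l) \<le> l * gap w s + M" by (simp only: s_def)
    then have "l * h \<le> M" by (simp only: h distrib_left)
    moreover have "i * h \<le> l * h" using i by simp
    ultimately show ?thesis by (simp only: h distrib_left)
  qed
  finally have hi: "w (s + i) \<le> w s + i * gap w s + M" .
  let ?q = "(w s + i * gap w s) div M"
  have "?q \<le> w (s + i) div M" using lo by (rule div_le_mono)
  moreover have "w (s + i) div M \<le> Suc ?q"
    using div_le_mono[OF hi, of M] M by simp
  ultimately have "w (s + i) div M = ?q \<or> w (s + i) div M = Suc ?q" by linarith
  with gi avoid[OF sk] show False by auto
qed

section \<open>Choosing the omitted colours by counting\<close>

text \<open>The position pairs are disjoint, so each independently avoids \<open>(c, c)\<close> in
  \<open>n\<^sup>2 - 1\<close> of \<open>n\<^sup>2\<close> ways. The denominators are multiplied out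
  to stay within \<open>nat\<close>.\<close>

lemma card_avoiding_pairs:
  fixes q :: "nat \<Rightarrow> nat" and c n l :: nat
  assumes q: "\<And>i. q i + 2 \<le> q (Suc i)"
    and "finite A" "\<And>i. i < l \<Longrightarrow> q i \<in> A \<and> Suc (q i) \<in> A" "c < n"
  shows "card {g \<in> A \<rightarrow>\<^sub>E {..<n}. \<forall>i<l. \<not> (g (q i) = c \<and> g (Suc (q i)) = c)} * (n\<^sup>2) ^ l
           \<le> n ^ card A * (n\<^sup>2 - 1) ^ l"
  using assms(2,3)
proof (induction l arbitrary: A)
  case 0
  then show ?case by (simp add: card_PiE)
next
  case (Suc l)
  have less: "q i + 2 \<le> q j" if "i < j" for i j
    using that
  proof (induction j)
    case (Suc j)
    then show ?case using q[of j] by (cases "i = j") auto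
  qed simp
  let ?x = "q l" and ?y = "Suc (q l)"
  define A' where "A' = A - {?x, ?y}"
  let ?S = "\<lambda>A l. {g \<in> A \<rightarrow>\<^sub>E {..<n}. \<forall>i<l. \<not> (g (q i) = c \<and> g (Suc (q i)) = c)}"
  have xy: "?x \<in> A" "?y \<in> A" using Suc.prems(2)[of l] by auto
  have cA: "card A = card A' + 2"
  proof -
    have "card {?x, ?y} \<le> card A" using xy Suc.prems(1) by (intro card_mono) auto
    moreover have "card A' = card A - card {?x, ?y}"
      unfolding A'_def using xy by (intro card_Diff_subset) auto
    ultimately show ?thesis by simp
  qed
  have A': "q i \<in> A'" "Suc (q i) \<in> A'" if "i < l" for i
    using Suc.prems(2)[of i] less[OF that] that by (auto simp: A'_def)
  let ?P = "{..<n} \<times> {..<n} - {(c, c)}"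
  \<comment> \<open>A function is determined by its values on the last pair and its restriction to
    the rest, which avoids the first \<open>l\<close> pairs.\<close>
  let ?h = "\<lambda>g. ((g ?x, g ?y), restrict g A')"
  have cP: "card ?P = n\<^sup>2 - 1"
    using assms(4) by (simp add: card_Diff_singleton power2_eq_square)
  have inj: "inj_on ?h (?S A (Suc l))"
  proof (rule inj_onI)
    fix g g' assume g: "g \<in> ?S A (Suc l)" "g' \<in> ?S A (Suc l)" and eq: "?h g = ?h g'"
    have "restrict g A' z = restrict g' A' z" for z using eq by simp
    then have "g z = g' z" if "z \<in> A'" for z using that by (metis restrict_apply')
    moreover have "g ?x = g' ?x" "g ?y = g' ?y" using eq by auto
    ultimately have "g z = g' z" if "z \<in> A" for z using that by (auto simp: A'_def)
    then show "g = g'" using g by (intro PiE_ext[of g A _ g']) auto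
  qed
  have sub: "?h ` ?S A (Suc l) \<subseteq> ?P \<times> ?S A' l"
  proof (rule image_subsetI)
    fix g assume g: "g \<in> ?S A (Suc l)"
    have "(g ?x, g ?y) \<in> ?P" using g xy by (auto simp: PiE_iff)
    moreover have "restrict g A' \<in> ?S A' l"
      using g A' by (auto simp: PiE_iff A'_def)
    ultimately show "?h g \<in> ?P \<times> ?S A' l" by auto
  qed
  have fin: "finite (?P \<times> ?S A' l)"
    using Suc.prems(1) by (auto simp: A'_def intro!: finite_cartesian_product finite_PiE
        finite_subset[OF _ finite_PiE[of A' "\<lambda>_. {..<n}"]])
  have "card (?S A (Suc l)) \<le> (n\<^sup>2 - 1) * card (?S A' l)"
    using card_inj_on_le[OF inj sub fin] by (simp only: card_cartesian_product cP)
  then have "card (?S A (Suc l)) * (n\<^sup>2) ^ Suc l \<le> (n\<^sup>2 - 1) * card (?S A' l) * (n\<^sup>2) ^ Suc l"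
    by (rule mult_le_mono1)
  also have "\<dots> = (n\<^sup>2 - 1) * n\<^sup>2 * (card (?S A' l) * (n\<^sup>2) ^ l)" by simp
  also have "\<dots> \<le> (n\<^sup>2 - 1) * n\<^sup>2 * (n ^ card A' * (n\<^sup>2 - 1) ^ l)"
    using Suc.prems(1) A' by (intro mult_le_mono2 Suc.IH) (auto simp: A'_def)
  also have "\<dots> = n ^ card A * (n\<^sup>2 - 1) ^ Suc l"
    by (simp add: cA power_add power2_eq_square)
  finally show ?case .
qed

text \<open>A union bound: each of at most \<open>n * (Suc N)\<^sup>2\<close> triples of colour,
  start and difference spoils at most a proportion \<open>((n\<^sup>2 - 1) / n\<^sup>2) ^ l\<close>
  of all functions, so some function survives.\<close>

lemma hits_progressions_exists:
  fixes n M l N :: nat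
  assumes "0 < M" and n: "0 < n"
    and union: "n * (Suc N)\<^sup>2 * (n\<^sup>2 - 1) ^ l < (n\<^sup>2) ^ l"
  shows "\<exists>g. (\<forall>x. g x < n) \<and> hits_progressions n M l N g"
proof -
  \<comment> \<open>Contains every block index that occurs, successors included, since
    \<open>a + i * d \<le> N + l * N\<close>.\<close>
  define A where "A = {..Suc (N + l * N)}"
  define F where "F = A \<rightarrow>\<^sub>E {..<n}"
  define I where "I = {(c, a, d). c < n \<and> a \<le> N \<and> d \<le> N \<and> 2 * M \<le> d}"
  define bad where "bad = (\<lambda>(c, a, d). {g \<in> F. \<forall>i<l.
     \<not> (g ((a + i * d) div M) = c \<and> g (Suc ((a + i * d) div M)) = c)})"
  have IS: "I \<subseteq> {..<n} \<times> {..N} \<times> {..N}" by (auto simp: I_def)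
  then have finI: "finite I" by (rule finite_subset) simp
  have cI: "card I \<le> n * (Suc N)\<^sup>2"
    using card_mono[OF _ IS] by (simp add: power2_eq_square)
  have finF: "finite F" by (simp add: F_def A_def finite_PiE)
  have cF: "card F = n ^ card A" by (simp add: F_def A_def card_PiE)
  have bad: "card (bad p) * (n\<^sup>2) ^ l \<le> card F * (n\<^sup>2 - 1) ^ l" if p: "p \<in> I" for p
  proof -
    obtain c a d where pe: "p = (c, a, d)" by (cases p)
    with p have cad: "c < n" "a \<le> N" "d \<le> N" "2 * M \<le> d" by (auto simp: I_def)
    have "card {g \<in> A \<rightarrow>\<^sub>E {..<n}. \<forall>i<l. \<not> (g ((a + i * d) div M) = c \<and> g (Suc ((a + i * d) div M)) = c)}
        * (n\<^sup>2) ^ l \<le> n ^ card A * (n\<^sup>2 - 1) ^ l"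
    proof (rule card_avoiding_pairs[where q = "\<lambda>i. (a + i * d) div M"])
      fix i
      have "(a + i * d) div M + 2 = (a + i * d + 2 * M) div M" using assms(1) by simp
      also have "\<dots> \<le> (a + Suc i * d) div M" using cad by (intro div_le_mono) simp
      finally show "(a + i * d) div M + 2 \<le> (a + Suc i * d) div M" .
    next
      fix i assume "i < l"
      have "(a + i * d) div M \<le> a + i * d" by simp
      also have "\<dots> \<le> N + l * N" using cad \<open>i < l\<close> by (intro add_mono mult_le_mono) auto
      finally show "(a + i * d) div M \<in> A \<and> Suc ((a + i * d) div M) \<in> A" by (simp add: A_def)
    qed (use cad in \<open>auto simp: A_def\<close>)
    then show ?thesis by (simp add: pe bad_def F_def cF[unfolded F_def])
  qed
  have "card (\<Union>p\<in>I. bad p) * (n\<^sup>2) ^ l \<le> (\<Sum>p\<in>I. card (bad p)) * (n\<^sup>2) ^ l"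
    by (intro mult_le_mono1 card_UN_le finI)
  also have "\<dots> \<le> (\<Sum>p\<in>I. card F * (n\<^sup>2 - 1) ^ l)"
    unfolding sum_distrib_right by (intro sum_mono bad)
  also have "\<dots> = card I * (n\<^sup>2 - 1) ^ l * card F" by simp
  also have "\<dots> \<le> n * (Suc N)\<^sup>2 * (n\<^sup>2 - 1) ^ l * card F"
    by (intro mult_le_mono1 cI)
  also have "\<dots> < (n\<^sup>2) ^ l * card F"
    using union n by (simp add: cF)
  finally have "card (\<Union>p\<in>I. bad p) < card F" by (simp add: mult.commute)
  moreover have "finite (\<Union>p\<in>I. bad p)"
    by (rule finite_subset[OF _ finF]) (auto simp: bad_def)
  ultimately have "\<not> F \<subseteq> (\<Union>p\<in>I. bad p)"
    using card_mono leD by blast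
  then obtain g where g: "g \<in> F" "\<And>p. p \<in> I \<Longrightarrow> g \<notin> bad p" by blast
  \<comment> \<open>Members of \<open>F\<close> are \<open>undefined\<close> outside
    \<open>A\<close>; the value there is reset to a legal colour.\<close>
  define g' where "g' x = (if x \<in> A then g x else 0)" for x
  have "\<forall>x. g' x < n" using g(1) n by (auto simp: g'_def F_def PiE_iff)
  moreover have "hits_progressions n M l N g'"
    unfolding hits_progressions_def
  proof (intro allI impI)
    fix c a d assume cad: "c < n" "a \<le> N" "d \<le> N" "2 * M \<le> d"
    then have "g \<notin> bad (c, a, d)" by (intro g(2)) (simp add: I_def)
    with g(1) obtain i where i: "i < l" "g ((a + i * d) div M) = c" "g (Suc ((a + i * d) div M)) = c"
      by (auto simp: bad_def)
    have "(a + i * d) div M \<le> a + i * d" by simp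
    also have "\<dots> \<le> N + l * N" using cad i by (intro add_mono mult_le_mono) auto
    finally have "(a + i * d) div M \<in> A" "Suc ((a + i * d) div M) \<in> A" by (simp_all add: A_def)
    with i show "\<exists>i<l. g' ((a + i * d) div M) = c \<and> g' (Suc ((a + i * d) div M)) = c"
      unfolding g'_def by auto
  qed
  ultimately show ?thesis by blast
qed

section \<open>Finiteness of \<open>AW\<close> and its lower bound by colourings\<close>

text \<open>Any increasing sequence of powers of two is an ascending wave, so the pigeonhole principle
  shows that the \<open>LEAST\<close> in the definition of \<open>AW\<close> is attained.\<close>

lemma mono_wave_exists:
  assumes c: "\<forall>x\<in>{1..2 ^ (r * k)}. c x < r"
  shows "has_mono_wave k (2 ^ (r * k)) c"
proof -
  define S where "S j = {i \<in> {..r * k}. c (2 ^ i) = j}" for j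
  have "\<exists>j<r. k \<le> card (S j)"
  proof (rule ccontr)
    assume "\<not> ?thesis"
    then have small: "card (S j) \<le> k" if "j < r" for j using that by force
    have "{..r * k} = (\<Union>j<r. S j)"
      using c by (auto simp: S_def intro!: power_increasing)
    then have "card {..r * k} \<le> (\<Sum>j<r. card (S j))" by (simp add: card_UN_le)
    also have "\<dots> \<le> (\<Sum>j<r. k)" by (intro sum_mono small) simp
    finally show False by simp
  qed
  then obtain j where j: "k \<le> card (S j)" by blast
  define xs where "xs = take k (sorted_list_of_set (S j))"
  have fin: "finite (S j)" by (simp add: S_def)
  have len: "length xs = k" using j by (simp add: xs_def)
  have set: "set xs \<subseteq> S j"
    using set_take_subset[of k "sorted_list_of_set (S j)"] fin by (simp add: xs_def)
  have "sorted_wrt (<) xs"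
    unfolding xs_def by (intro sorted_wrt_take) simp
  then have lt: "xs ! i < xs ! (i + 1)" if "i + 1 < k" for i
    using that len by (simp add: sorted_wrt_nth_less)
  have "ascending_wave (map (\<lambda>i. 2 ^ i) xs)"
    unfolding ascending_wave_def
  proof (intro conjI allI impI)
    fix i assume i: "0 < i \<and> i + 1 < length (map (\<lambda>i. 2 ^ i :: nat) xs)"
    \<comment> \<open>Exponents grow by at least one, so the next gap is at least the current term,
      hence at least the preceding gap.\<close>
    have "Suc (xs ! i) \<le> xs ! (i + 1)" using lt[of i] i len by simp
    then have "(2::nat) ^ Suc (xs ! i) \<le> 2 ^ (xs ! (i + 1))" by (intro power_increasing) auto
    then show "map (\<lambda>i. 2 ^ i :: nat) xs ! i - map (\<lambda>i. 2 ^ i) xs ! (i - 1)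
        \<le> map (\<lambda>i. 2 ^ i) xs ! (i + 1) - map (\<lambda>i. 2 ^ i) xs ! i"
      using i len by simp
  qed (use lt len in auto)
  moreover have "set (map (\<lambda>i. 2 ^ i) xs) \<subseteq> {1..2 ^ (r * k) :: nat}"
    using set by (auto simp: S_def)
  moreover have "\<forall>x\<in>set (map (\<lambda>i. 2 ^ i) xs). c x = j"
    using set by (auto simp: S_def)
  ultimately show ?thesis
    unfolding has_mono_wave_def using len by (metis length_map)
qed

text \<open>If \<open>AW k r\<close> were at most \<open>N\<close>, the colouring shifted by one
  would restrict to \<open>{1..AW k r}\<close> and contain a monochromatic wave, because the minimum
  is attained by \<open>mono_wave_exists\<close>.\<close>

lemma less_AW:
  assumes f: "\<And>x. x < N \<Longrightarrow> f x < r" and free: "wave_free k N f"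
  shows "N < AW k r"
proof (rule ccontr)
  assume le: "\<not> N < AW k r"
  let ?P = "\<lambda>N. 0 < N \<and> (\<forall>c. (\<forall>x\<in>{1..N}. c x < r) \<longrightarrow> has_mono_wave k N c)"
  have "?P (2 ^ (r * k))" using mono_wave_exists by simp
  then have "?P (AW k r)" unfolding AW_def by (rule LeastI)
  moreover have "\<forall>x\<in>{1..AW k r}. f (x - 1) < r" using f le by auto
  ultimately have "has_mono_wave k (AW k r) (\<lambda>x. f (x - 1))" by simp
  then obtain w where w: "length w = k" "ascending_wave w" "set w \<subseteq> {1..AW k r}"
    and col: "\<forall>x\<in>set w. \<forall>y\<in>set w. f (x - 1) = f (y - 1)"
    unfolding has_mono_wave_def by blast
  have pos: "1 \<le> w ! i" "w ! i \<le> N" if "i < k" for i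
  proof -
    have "w ! i \<in> {1..AW k r}" using w(1,3) that nth_mem[of i w] by blast
    then show "1 \<le> w ! i" "w ! i \<le> N" using le by auto
  qed
  have "wave k (\<lambda>i. w ! i - 1)"
    unfolding wave_def
  proof (intro conjI allI impI)
    fix i assume i: "Suc i < k"
    then have "w ! i < w ! (i + 1)" using w(1,2) unfolding ascending_wave_def by simp
    then show "w ! i - 1 < w ! Suc i - 1" using pos(1)[of i] i by simp
  next
    fix i assume i: "Suc (Suc i) < k"
    have "w ! i < w ! (i + 1)" "w ! (i + 1) < w ! (i + 1 + 1)"
      using w(1,2) i unfolding ascending_wave_def by simp_all
    moreover have "w ! (i + 1) - w ! (i + 1 - 1) \<le> w ! (i + 1 + 1) - w ! (i + 1)"
      using w(2)[unfolded ascending_wave_def, THEN conjunct2, THEN conjunct2, rule_format, of "i + 1"]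
        w(1) i by simp
    ultimately show "2 * (w ! Suc i - 1) \<le> w ! i - 1 + (w ! Suc (Suc i) - 1)"
      using pos(1)[of i] i by simp
  qed
  moreover have "\<forall>i<k. w ! i - 1 < N" using pos by force
  moreover have "\<forall>i<k. f (w ! i - 1) = f (w ! 0 - 1)"
  proof (intro allI impI)
    fix i assume "i < k"
    then have "w ! i \<in> set w" "w ! 0 \<in> set w" using w(1) by (auto intro!: nth_mem)
    with col show "f (w ! i - 1) = f (w ! 0 - 1)" by blast
  qed
  ultimately show False using free unfolding wave_free_def by blast
qed

section \<open>Asymptotics and the induction on the number of colours\<close>

lemma union_bound_eventually:
  fixes a b c \<delta> :: real
  assumes "b > 0" "\<delta> > 0" "a > 0" "c > 0"
  shows "\<forall>\<^sub>F k in sequentially. c * (real k powr a + 1) ^ 2 * exp (- b * (real k powr \<delta> - 1)) < 1"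
  using assms by real_asymp

lemma div_half_lower:
  fixes a b :: nat
  assumes "b \<le> a"
  shows "real a / (2 * real b) \<le> real (a div b)"
proof (cases "b = 0")
  case False
  have "a mod b < b" using False by simp
  also have "b \<le> a div b * b"
    using assms False by (simp add: div_greater_zero_iff Suc_leI)
  finally have "a \<le> 2 * (a div b * b)"
    using div_mult_mod_eq[of a b] by linarith
  then have "real a \<le> 2 * (real (a div b) * real b)"
    by (metis of_nat_le_iff of_nat_mult of_nat_numeral)
  with False show ?thesis by (simp add: field_simps)
qed simp

text \<open>The induction also carries \<open>N \<le> k ^ (2 * r)\<close>, which keeps the number of
  progressions in the union bound polynomial in \<open>k\<close>.\<close>

lemma wave_avoiding_coloring:
  fixes r :: nat and \<epsilon> :: real
  assumes "1 \<le> r" "0 < \<epsilon>" "\<epsilon> \<le> 1"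
  shows "\<forall>\<^sub>F k in sequentially. \<exists>N f. real k powr (2 * real r - 1 - \<epsilon>) \<le> real N \<and> N \<le> k ^ (2 * r) \<and>
           (\<forall>x<N. f x < r) \<and> wave_free k N f"
  using assms
proof (induction r arbitrary: \<epsilon> rule: nat_induct_at_least)
  case base
  have "\<forall>\<^sub>F k in sequentially. real k powr (1 - \<epsilon>) \<le> real k - 1"
    using base by real_asymp
  then show ?case
    using eventually_ge_at_top[of 1]
  proof eventually_elim
    case (elim k)
    \<comment> \<open>With one colour, \<open>k\<close> strictly increasing terms do not fit into
      \<open>k - 1\<close> points.\<close>
    have "wave_free k (k - 1) (\<lambda>_. 0)"
      unfolding wave_free_def
    proof (intro notI, elim exE conjE)
      fix w assume w: "wave k w" "\<forall>i<k. w i < k - 1"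
      have "i \<le> w i" if "i < k" for i
        using that
      proof (induction i)
        case (Suc i)
        with w(1) have "w i < w (Suc i)" by (simp add: wave_def)
        with Suc show ?case by simp
      qed simp
      from this[of "k - 1"] w(2)[rule_format, of "k - 1"] elim(2) show False by simp
    qed
    moreover have "k - 1 \<le> k ^ 2" by (cases k) (auto simp: power2_eq_square)
    ultimately show ?case
      using elim by (intro exI[of _ "k - 1"] exI[of _ "\<lambda>_. 0"]) (auto simp: of_nat_diff)
  qed
next
  case (Suc r)
  define n where "n = Suc r"
  \<comment> \<open>The exponent loss in \<open>lower\<close> is at most
    \<open>\<epsilon> / 2 + \<delta> + 4 * \<delta> * r\<close>, where
    \<open>4 * \<delta> * r\<close> is now \<open>\<epsilon> / 4\<close>.\<close>
  define \<delta> where "\<delta> = \<epsilon> / (16 * real r)"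
  have r: "1 \<le> real r" using Suc.hyps by simp
  have \<delta>: "0 < \<delta>" using Suc.prems r by (simp add: \<delta>_def)
  have \<delta>r: "16 * (\<delta> * real r) = \<epsilon>" using r by (simp add: \<delta>_def)
  have \<delta>1: "\<delta> \<le> 1 / 16"
    using \<delta>r Suc.prems r \<delta> mult_left_mono[of 1 "real r" \<delta>] by linarith
  define l where "l k = nat \<lfloor>real k powr \<delta>\<rfloor>" for k :: nat
  \<comment> \<open>Fitted to \<open>wave_free_blocks\<close> with \<open>W\<close> about
    \<open>k / (4 * l)\<close> and \<open>R\<close> about \<open>k / 4\<close>: then
    \<open>2 * l * m\<close>, \<open>W * l\<close> and \<open>R\<close> are each at most
    \<open>k / 4\<close>, and \<open>B * l\<close> is about half of \<open>W * R\<close>.\<close>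
  define m where "m k = k div (8 * l k)" for k
  define B where "B k = k\<^sup>2 div (32 * (l k)\<^sup>2)" for k
  \<comment> \<open>The probability that two given blocks do not both omit a given colour.\<close>
  define q where "q = (real n ^ 2 - 1) / real n ^ 2"
  have n2: "1 < real n ^ 2" using r by (simp add: n_def)
  have n0: "0 < n" by (simp add: n_def)
  have q: "0 < q" "q < 1" using n2 n0 by (simp_all add: q_def zero_less_divide_iff divide_less_eq)
  \<comment> \<open>The 64 absorbs the constants 16 and 64 from halving the quotients
    \<open>m\<close> and \<open>B\<close>; the 20 below gives
    \<open>5 \<le> k div (4 * l k)\<close>.\<close>
  have ev1: "\<forall>\<^sub>F k in sequentially. 64 \<le> real k powr \<delta>" using \<delta> by real_asymp
  have ev2: "\<forall>\<^sub>F k in sequentially. 20 * real k powr \<delta> \<le> real k" using \<delta> \<delta>1 by real_asymp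
  have ev3: "\<forall>\<^sub>F k in sequentially. real n * (real k powr (2 * real n) + 1) ^ 2
      * exp (- (- ln q) * (real k powr \<delta> - 1)) < 1"
    using q \<delta> by (intro union_bound_eventually) (auto simp: n_def)

  have bounds: "1 \<le> l k" "20 * l k \<le> k" "real (l k) \<le> real k powr \<delta>" "real k powr \<delta> - 1 \<le> real (l k)"
      "real k powr (1 - 2 * \<delta>) \<le> real (m k)" "real k powr (2 - 3 * \<delta>) \<le> real (B k)"
    if k: "64 \<le> real k powr \<delta>" "20 * real k powr \<delta> \<le> real k" for k
  proof -
    have k0: "0 < real k" using k by linarith
    show l1: "1 \<le> l k" using k(1) unfolding l_def by linarith
    show lk: "real (l k) \<le> real k powr \<delta>" "real k powr \<delta> - 1 \<le> real (l k)"
      unfolding l_def using k(1) by linarith+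
    show l20: "20 * l k \<le> k" using lk(1) k(2) by linarith
    have quot: "real k / real k powr \<delta> = real k powr (1 - \<delta>)"
      using k0 by (simp add: powr_diff)
    have "real k powr (1 - 2 * \<delta>) * 16 \<le> real k powr (1 - 2 * \<delta>) * real k powr \<delta>"
      using k(1) by (intro mult_left_mono) auto
    also have "\<dots> = real k / real k powr \<delta>"
      by (simp add: quot flip: powr_add)
    also have "\<dots> \<le> real k / real (l k)"
      using lk(1) l1 k0 by (intro divide_left_mono mult_pos_pos) auto
    finally have "real k powr (1 - 2 * \<delta>) \<le> real k / (2 * real (8 * l k))"
      by simp
    also have "\<dots> \<le> real (m k)"
      unfolding m_def using l20 by (intro div_half_lower) simp
    finally show "real k powr (1 - 2 * \<delta>) \<le> real (m k)" .
    have "real k powr (2 - 3 * \<delta>) * 64 \<le> real k powr (2 - 3 * \<delta>) * real k powr \<delta>"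
      using k(1) by (intro mult_left_mono) auto
    also have "\<dots> = (real k / real k powr \<delta>) ^ 2"
      unfolding quot by (simp add: power2_eq_square flip: powr_add)
    also have "\<dots> \<le> (real k / real (l k)) ^ 2"
      using lk(1) l1 k0 by (intro power_mono divide_left_mono mult_pos_pos) auto
    finally have "real k powr (2 - 3 * \<delta>) \<le> real (k\<^sup>2) / (2 * real (32 * (l k)\<^sup>2))"
      by (simp add: power_divide)
    also have "\<dots> \<le> real (B k)"
      unfolding B_def
    proof (intro div_half_lower)
      have "(20 * l k)\<^sup>2 \<le> k\<^sup>2" using l20 by (intro power_mono) auto
      then show "32 * (l k)\<^sup>2 \<le> k\<^sup>2" by (simp add: power_mult_distrib)
    qed
    finally show "real k powr (2 - 3 * \<delta>) \<le> real (B k)" .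
  qed

  \<comment> \<open>The induction hypothesis is used at \<open>m k\<close>, which must therefore
    tend to infinity.\<close>
  have "filterlim (\<lambda>k. real (m k)) at_top sequentially"
  proof (rule filterlim_at_top_mono)
    show "filterlim (\<lambda>k. real k powr (1 - 2 * \<delta>)) at_top sequentially"
      using \<delta>1 by real_asymp
    show "\<forall>\<^sub>F k in sequentially. real k powr (1 - 2 * \<delta>) \<le> real (m k)"
      using ev1 ev2 by eventually_elim (rule bounds)
  qed
  then have "filterlim m at_top sequentially"
    by (simp add: filterlim_sequentially_iff_filterlim_real)
  moreover have "\<forall>\<^sub>F k in sequentially. \<exists>N f. real k powr (2 * real r - 1 - \<epsilon> / 2) \<le> real N \<and>
      N \<le> k ^ (2 * r) \<and> (\<forall>x<N. f x < r) \<and> wave_free k N f"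
    using Suc.prems by (intro Suc.IH) auto
  ultimately have "\<forall>\<^sub>F k in sequentially. \<exists>N f. real (m k) powr (2 * real r - 1 - \<epsilon> / 2) \<le> real N \<and>
      N \<le> m k ^ (2 * r) \<and> (\<forall>x<N. f x < r) \<and> wave_free (m k) N f"
    by (rule eventually_compose_filterlim[rotated])
  then show ?case
    using ev1 ev2 ev3
  proof eventually_elim
    case (elim k)
    note bnd = bounds[OF elim(2,3)]
    have k0: "1 \<le> k" using bnd(1,2) by linarith
    from elim(1) obtain M \<phi> where M: "real (m k) powr (2 * real r - 1 - \<epsilon> / 2) \<le> real M"
      "M \<le> m k ^ (2 * r)" "\<And>x. x < M \<Longrightarrow> \<phi> x < r" "wave_free (m k) M \<phi>" by blast
    have "0 < real k powr (1 - 2 * \<delta>)" using k0 by simp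
    then have m0: "0 < real (m k)" using bnd(5) by linarith
    then have "0 < real (m k) powr (2 * real r - 1 - \<epsilon> / 2)" by simp
    then have M0: "0 < M" using M(1) by linarith
    have B2: "2 \<le> B k"
    proof -
      have "(20 * l k)\<^sup>2 \<le> k\<^sup>2" using bnd(2) by (intro power_mono) auto
      then have "2 * (32 * (l k)\<^sup>2) \<le> k\<^sup>2" by (simp add: power_mult_distrib)
      then show ?thesis using bnd(1) unfolding B_def by (simp add: less_eq_div_iff_mult_less_eq)
    qed
    have upper: "B k * M \<le> k ^ (2 * n)"
    proof -
      have "B k \<le> k ^ 2" by (simp add: B_def)
      moreover have "M \<le> k ^ (2 * r)"
        using M(2) by (rule order_trans) (simp add: m_def power_mono)
      ultimately have "B k * M \<le> k ^ 2 * k ^ (2 * r)" by (rule mult_le_mono)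
      also have "\<dots> = k ^ (2 * n)" by (simp add: n_def power_add[symmetric])
      finally show ?thesis .
    qed
    have lower: "real k powr (2 * real n - 1 - \<epsilon>) \<le> real (B k * M)"
    proof -
      have "2 * real n - 1 - \<epsilon> \<le> (2 - 3 * \<delta>) + (1 - 2 * \<delta>) * (2 * real r - 1 - \<epsilon> / 2)"
      proof -
        have "0 \<le> \<delta> * \<epsilon>" "\<delta> \<le> \<delta> * real r"
          using \<delta> Suc.prems r mult_left_mono[of 1 "real r" \<delta>] by auto
        moreover have "(2 - 3 * \<delta>) + (1 - 2 * \<delta>) * (2 * real r - 1 - \<epsilon> / 2)
            = 2 * real n - 1 - \<epsilon> / 2 - \<delta> - 4 * (\<delta> * real r) + \<delta> * \<epsilon>"
          by (simp add: n_def algebra_simps)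
        ultimately show ?thesis using \<delta>r Suc.prems by linarith
      qed
      then have "real k powr (2 * real n - 1 - \<epsilon>)
          \<le> real k powr ((2 - 3 * \<delta>) + (1 - 2 * \<delta>) * (2 * real r - 1 - \<epsilon> / 2))"
        using k0 by (intro powr_mono) auto
      also have "\<dots> = real k powr (2 - 3 * \<delta>) * (real k powr (1 - 2 * \<delta>)) powr (2 * real r - 1 - \<epsilon> / 2)"
        by (simp add: powr_add powr_powr)
      also have "\<dots> \<le> real (B k) * real M"
        using bnd(5,6) M(1) r Suc.prems
        by (intro mult_mono order_trans[OF powr_mono2 M(1)]) auto
      finally show ?thesis by simp
    qed
    \<comment> \<open>Divided by \<open>(n\<^sup>2) ^ l k\<close> over the reals, this follows from
      \<open>elim(4)\<close>, whose exponent has a \<open>- 1\<close> to pay for the rounding in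
      \<open>l k\<close>.\<close>
    have "n * (Suc (B k * M))\<^sup>2 * (n\<^sup>2 - 1) ^ l k < (n\<^sup>2) ^ l k"
    proof -
      have "real n * (real (Suc (B k * M)))\<^sup>2 * q ^ l k
          \<le> real n * (real k powr (2 * real n) + 1) ^ 2 * exp (- (- ln q) * (real k powr \<delta> - 1))"
      proof (intro mult_mono power_mono)
        have "real (B k * M) \<le> real (k ^ (2 * n))" using upper by (simp only: of_nat_le_iff)
        also have "\<dots> = real k powr (2 * real n)"
          using k0 powr_realpow[of "real k" "2 * n"] by simp
        finally show "real (Suc (B k * M)) \<le> real k powr (2 * real n) + 1" by simp
        have "q ^ l k = q powr real (l k)" using q by (simp add: powr_realpow)
        also have "\<dots> \<le> q powr (real k powr \<delta> - 1)"
          using bnd(4) q by (intro powr_mono') auto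
        also have "\<dots> = exp (- (- ln q) * (real k powr \<delta> - 1))"
          using q by (simp add: powr_def mult.commute)
        finally show "q ^ l k \<le> exp (- (- ln q) * (real k powr \<delta> - 1))" .
      qed (use q in auto)
      with elim(4) have *: "real n * (real (Suc (B k * M)))\<^sup>2 * q ^ l k < 1" by linarith
      have "real n * (real (Suc (B k * M)))\<^sup>2 * (real n ^ 2 - 1) ^ l k
          = (real n * (real (Suc (B k * M)))\<^sup>2 * q ^ l k) * (real n ^ 2) ^ l k"
        using n2 by (simp add: q_def power_divide)
      also have "\<dots> < 1 * (real n ^ 2) ^ l k"
        using * n0 by (intro mult_strict_right_mono) auto
      finally have "real (n * (Suc (B k * M))\<^sup>2 * (n\<^sup>2 - 1) ^ l k) < real ((n\<^sup>2) ^ l k)"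
        using n0 by (simp add: of_nat_diff)
      then show ?thesis by (simp only: of_nat_less_iff)
    qed
    then obtain g where g: "\<And>x. g x < n" "hits_progressions n M (l k) (B k * M) g"
      using hits_progressions_exists[OF M0 n0] by blast
    define f where "f x = skip (g (x div M)) (\<phi> (x mod M))" for x
    have "wave_free k (B k * M) f"
      unfolding f_def
    proof (rule wave_free_blocks[where W = "k div (4 * l k)" and R = "k div 4"])
      have "8 * l k * m k \<le> k" "4 * l k * (k div (4 * l k)) \<le> k" "4 * (k div 4) \<le> k"
        unfolding m_def by (rule times_div_less_eq_dividend)+
      then show "2 * l k * m k + k div (4 * l k) * l k + k div 4 < k"
        using k0 by (simp add: algebra_simps)
      \<comment> \<open>Rounding down is paid for by 5 in place of 4; \<open>5 * 5 < 32\<close> then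
        leaves room for the strict inequality.\<close>
      have W: "real k / (5 * l k) \<le> real (k div (4 * l k))"
      proof -
        have "k mod (4 * l k) < 4 * l k" using bnd(1) by simp
        then have "k < 4 * l k * (k div (4 * l k)) + 4 * l k"
          using mult_div_mod_eq[of "4 * l k" k] by linarith
        moreover have "5 \<le> k div (4 * l k)"
          using bnd(1,2) by (simp add: less_eq_div_iff_mult_less_eq)
        then have "l k * 5 \<le> l k * (k div (4 * l k))" by (rule mult_le_mono2)
        ultimately have "k \<le> 5 * l k * (k div (4 * l k))"
          unfolding mult.assoc by linarith
        then have "real k \<le> 5 * real (l k) * real (k div (4 * l k))"
          by (metis of_nat_le_iff of_nat_mult of_nat_numeral)
        then show ?thesis using bnd(1) by (simp add: field_simps)
      qed
      have R: "real k / 5 \<le> real (k div 4)"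
        using bnd(1,2) by linarith
      have "real (B k) * real (l k) \<le> real (k\<^sup>2) / real (32 * (l k)\<^sup>2) * real (l k)"
        unfolding B_def by (intro mult_right_mono of_nat_div_le_of_nat) simp
      also have "\<dots> = real k ^ 2 / (32 * real (l k))"
        using bnd(1) by (simp add: field_simps power2_eq_square)
      also have "\<dots> < real k ^ 2 / (25 * real (l k))"
        using bnd(1) k0 by (intro divide_strict_left_mono) auto
      also have "\<dots> = real k / (5 * l k) * (real k / 5)" by (simp add: power2_eq_square)
      also have "\<dots> \<le> real (k div (4 * l k)) * real (k div 4)"
        by (intro mult_mono W R) auto
      finally show "B k * l k < k div (4 * l k) * (k div 4)"
        by (simp only: of_nat_mult[symmetric] of_nat_less_iff)
    qed (use M g M0 B2 in \<open>auto simp: n_def\<close>)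
    moreover have "\<forall>x<B k * M. f x < Suc r"
      unfolding f_def using M(3) M0 by (auto intro!: skip_less)
    ultimately show ?case
      using lower upper unfolding n_def by blast
  qed
qed

theorem theorem2:
  fixes r :: nat and \<epsilon> :: real
  assumes "r \<ge> 1" and "\<epsilon> > 0"
  shows "\<forall>\<^sub>F k in sequentially.
           real (AW k r) \<ge> real k powr (2 * real r - 1 - \<epsilon>)
              / (2 ^ (r - 1) * (40 * real r) ^ (r ^ 2 - 1))"
proof -
  \<comment> \<open>The minimum meets the condition \<open>\<epsilon> \<le> 1\<close> of the
    colouring lemma and, for \<open>1 \<le> k\<close>, can only raise the bound.\<close>
  have "\<forall>\<^sub>F k in sequentially. \<exists>N f. real k powr (2 * real r - 1 - min \<epsilon> 1) \<le> real N \<and> N \<le> k ^ (2 * r) \<and>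
           (\<forall>x<N. f x < r) \<and> wave_free k N f"
    using assms by (intro wave_avoiding_coloring) auto
  then show ?thesis
    using eventually_ge_at_top[of 1]
  proof eventually_elim
    case (elim k)
    then obtain N f where N: "real k powr (2 * real r - 1 - min \<epsilon> 1) \<le> real N"
      "\<And>x. x < N \<Longrightarrow> f x < r" "wave_free k N f" by blast
    have "(1::real) \<le> 2 ^ (r - 1) * (40 * real r) ^ (r\<^sup>2 - 1)"
      using assms(1) by (intro mult_ge1_I one_le_power) auto
    then have "real k powr (2 * real r - 1 - \<epsilon>) / (2 ^ (r - 1) * (40 * real r) ^ (r\<^sup>2 - 1))
        \<le> real k powr (2 * real r - 1 - \<epsilon>) / 1"
      by (intro divide_left_mono) auto
    also have "\<dots> \<le> real k powr (2 * real r - 1 - min \<epsilon> 1)"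
      using elim(2) by (simp add: powr_mono)
    also have "\<dots> \<le> real (AW k r)"
      using N(1) less_AW[of N f r k, OF N(2,3)] by simp
    finally show ?case .
  qed
qed

end
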